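(* Let $G=(V,E)$ be a finite connected graph with girth at least $6$. Then $$\mathrm{DN}_{\mathrm{LLY}}(G)<\infty\quad\Longleftrightarrow\quad G\text{ is a tree or }G=C_n\text{ for some }n\ge6.$$ Consequently, if $|E|>|V|$ then $\mathrm{DN}_{\mathrm{LLY}}(G)=\infty$, while if $|E|=|V|$ then $\mathrm{DN}_{\mathrm{LLY}}(G)<\infty$ exactly when $G$ is a cycle $C_n$ with $n\ge6$.
   Context: Graphs are simple and undirected; $C_n$ is the cycle of length $n$; the girth of a forest is infinite. Let $d(\cdot,\cdot)$ be the combinatorial graph distance. For a positive edge weight $w:E\to(0,\infty)$ put $d_x^w:=\sum_{y\sim x}w_{xy}$. For $\alpha\in[0,1]$ let $\mu_x^{\alpha,w}$ be the probability measure with $\mu_x^{\alpha,w}(x)=\alpha$, $\mu_x^{\alpha,w}(z)=(1-\alpha)w_{xz}/d_x^w$ for $z\sim x$, and $0$ otherwise. Let $W_1$ be the $1$-Wasserstein distance with respect to $d$. For $x\sim y$ let $\kappa_\alpha^w(x,y):=1-W_1(\mu_x^{\alpha,w},\mu_y^{\alpha,w})$ and define the weighted Lin--Lu--Yau curvature $\kappa_{\mathrm{LLY}}^w(x,y):=\lim_{\alpha\to1^-}\kappa_\alpha^w(x,y)/(1-\alpha)$. For connected locally finite $G$ with $E\neq\varnothing$: $\mathrm{Dist}(w):=\sup_{e\in E}w_e/\inf_{e\in E}w_e$, with value $+\infty$ if the supremum is infinite or the infimum is $0$; a positive weight $w$ is admissible if $\kappa_{\mathrm{LLY}}^w(e)\ge0$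 for every $e\in E$; and $\mathrm{DN}_{\mathrm{LLY}}(G):=\inf\{\mathrm{Dist}(w): w \text{ admissible}\}$, with value $+\infty$ if no admissible weight has finite distortion. By convention $\mathrm{DN}_{\mathrm{LLY}}(K_1)=1$. *)

theory Defs
  imports "HOL-Probability.Probability" "HOL-Library.Extended_Nat"
begin

section \<open>Simple graphs\<close>

text \<open>
  An edge is an unordered pair of distinct vertices, represented as a two-element set, so that
  a weight on edges is a function on sets and is symmetric by construction.
\<close>

locale simple_graph =
  fixes V :: "'a set" and E :: "'a set set"
  assumes edge_subset: "e \<in> E \<Longrightarrow> e \<subseteq> V"
    and edge_card: "e \<in> E \<Longrightarrow> card e = 2"

definition adj :: "'a set set \<Rightarrow> 'a \<Rightarrow> 'a \<Rightarrow> bool" where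
  "adj E x y \<longleftrightarrow> {x, y} \<in> E"

definition connected_graph :: "'a set \<Rightarrow> 'a set set \<Rightarrow> bool" where
  "connected_graph V E \<longleftrightarrow> V \<noteq> {} \<and> (\<forall>x\<in>V. \<forall>y\<in>V. (adj E)\<^sup>*\<^sup>* x y)"

text \<open>The distance is unspecified between vertices in different components.\<close>

definition graph_dist :: "'a set set \<Rightarrow> 'a \<Rightarrow> 'a \<Rightarrow> nat" where
  "graph_dist E x y = (LEAST n. (adj E ^^ n) x y)"

definition is_cycle :: "'a set set \<Rightarrow> 'a list \<Rightarrow> bool" where
  "is_cycle E c \<longleftrightarrow>
     length c \<ge> 3 \<and> distinct c \<and> successively (adj E) c \<and> adj E (last c) (hd c)"

text \<open>In \<^typ>\<open>enat\<close> the infimum of the empty set is \<open>\<infinity>\<close>, so forests have infinite girth.\<close>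

definition girth :: "'a set set \<Rightarrow> enat" where
  "girth E = (INF c \<in> {c. is_cycle E c}. enat (length c))"

definition is_tree :: "'a set \<Rightarrow> 'a set set \<Rightarrow> bool" where
  "is_tree V E \<longleftrightarrow> connected_graph V E \<and> (\<nexists>c. is_cycle E c)"

definition graph_iso :: "'a set \<Rightarrow> 'a set set \<Rightarrow> 'b set \<Rightarrow> 'b set set \<Rightarrow> bool" where
  "graph_iso V E V' E' \<longleftrightarrow> (\<exists>f. bij_betw f V V' \<and> (\<lambda>e. f ` e) ` E = E')"

text \<open>\<open>C\<^sub>n\<close> as a concrete graph; it is a cycle of length \<open>n\<close> only for \<open>n \<ge> 3\<close>.\<close>

definition cycle_verts :: "nat \<Rightarrow> nat set" where
  "cycle_verts n = {0..<n}"

definition cycle_edges :: "nat \<Rightarrow> nat set set" where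
  "cycle_edges n = (\<lambda>i. {i, Suc i mod n}) ` {0..<n}"

definition is_cycle_graph :: "nat \<Rightarrow> 'a set \<Rightarrow> 'a set set \<Rightarrow> bool" where
  "is_cycle_graph n V E \<longleftrightarrow> graph_iso V E (cycle_verts n) (cycle_edges n)"


section \<open>Weighted Lin--Lu--Yau curvature\<close>

definition wdeg :: "'a set set \<Rightarrow> ('a set \<Rightarrow> real) \<Rightarrow> 'a \<Rightarrow> real" where
  "wdeg E w x = (\<Sum>y \<in> {y. adj E x y}. w {x, y})"

definition walk_density :: "'a set set \<Rightarrow> ('a set \<Rightarrow> real) \<Rightarrow> real \<Rightarrow> 'a \<Rightarrow> 'a \<Rightarrow> real" where
  "walk_density E w \<alpha> x z =
     (if z = x then \<alpha> else if adj E x z then (1 - \<alpha>) * w {x, z} / wdeg E w x else 0)"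

text \<open>
  The measure with mass function \<^const>\<open>walk_density\<close>. It is meaningful when \<open>\<alpha> \<in> [0,1]\<close>,
  \<open>w\<close> is positive on \<open>E\<close> and \<open>x\<close> has at least one and only finitely many neighbours;
  see \<open>pmf_walk_measure\<close> below.
\<close>

definition walk_measure :: "'a set set \<Rightarrow> ('a set \<Rightarrow> real) \<Rightarrow> real \<Rightarrow> 'a \<Rightarrow> 'a pmf" where
  "walk_measure E w \<alpha> x = embed_pmf (walk_density E w \<alpha> x)"

definition couplings :: "'a pmf \<Rightarrow> 'a pmf \<Rightarrow> ('a \<times> 'a) pmf set" where
  "couplings \<mu> \<nu> = {\<pi>. map_pmf fst \<pi> = \<mu> \<and> map_pmf snd \<pi> = \<nu>}"

text \<open>
  The infimum is taken in the reals and the Bochner integral of a non-integrable function is 0,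
  so this is the Wasserstein distance only if the cost is integrable under every coupling, as it
  is for the finitely supported measures above.
\<close>

definition W1 :: "'a set set \<Rightarrow> 'a pmf \<Rightarrow> 'a pmf \<Rightarrow> real" where
  "W1 E \<mu> \<nu> =
     (INF \<pi> \<in> couplings \<mu> \<nu>. measure_pmf.expectation \<pi> (\<lambda>(u, v). real (graph_dist E u v)))"

definition kappa :: "'a set set \<Rightarrow> ('a set \<Rightarrow> real) \<Rightarrow> real \<Rightarrow> 'a \<Rightarrow> 'a \<Rightarrow> real" where
  "kappa E w \<alpha> x y = 1 - W1 E (walk_measure E w \<alpha> x) (walk_measure E w \<alpha> y)"

definition kappa_LLY :: "'a set set \<Rightarrow> ('a set \<Rightarrow> real) \<Rightarrow> 'a \<Rightarrow> 'a \<Rightarrow> real" where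
  "kappa_LLY E w x y = Lim (at_left 1) (\<lambda>\<alpha>. kappa E w \<alpha> x y / (1 - \<alpha>))"


section \<open>Distortion\<close>

definition weight_distortion :: "'a set set \<Rightarrow> ('a set \<Rightarrow> real) \<Rightarrow> ereal" where
  "weight_distortion E w =
     (let S = (SUP e\<in>E. ereal (w e)); I = (INF e\<in>E. ereal (w e))
      in if S = \<infinity> \<or> I = 0 then \<infinity> else S / I)"

definition positive_weight :: "'a set set \<Rightarrow> ('a set \<Rightarrow> real) \<Rightarrow> bool" where
  "positive_weight E w \<longleftrightarrow> (\<forall>e\<in>E. w e > 0)"

definition admissible :: "'a set set \<Rightarrow> ('a set \<Rightarrow> real) \<Rightarrow> bool" where
  "admissible E w \<longleftrightarrow>
     positive_weight E w \<and> (\<forall>x y. adj E x y \<longrightarrow> kappa_LLY E w x y \<ge> 0)"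

text \<open>
  The only connected graph without edges is the one-vertex graph, whose value is 1 by convention.
  In \<^typ>\<open>ereal\<close> the infimum of the empty set is \<open>\<infinity>\<close>.
\<close>

definition DN_LLY :: "'a set set \<Rightarrow> ereal" where
  "DN_LLY E = (if E = {} then 1 else (INF w \<in> {w. admissible E w}. weight_distortion E w))"


section \<open>Well-definedness of the walk measures\<close>

lemma (in simple_graph) not_adj_self: "\<not> adj E x x"
  using edge_card[of "{x, x}"] by (auto simp: adj_def)

lemma (in simple_graph) wdeg_pos:
  assumes fin: "finite {y. adj E x y}" and ex: "adj E x y" and pos: "positive_weight E w"
  shows "wdeg E w x > 0"
  unfolding wdeg_def
proof (rule sum_pos[OF fin])
  show "{y. adj E x y} \<noteq> {}" using ex by auto
qed (use pos in \<open>auto simp: positive_weight_def adj_def\<close>)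

lemma (in simple_graph) pmf_walk_measure:
  assumes fin: "finite {y. adj E x y}" and ex: "adj E x y" and pos: "positive_weight E w"
    and \<alpha>: "0 \<le> \<alpha>" "\<alpha> \<le> 1"
  shows "pmf (walk_measure E w \<alpha> x) z = walk_density E w \<alpha> x z"
  unfolding walk_measure_def
proof (rule pmf_embed_pmf)
  let ?N = "{y. adj E x y}"
  have d: "wdeg E w x > 0" by (rule wdeg_pos[OF fin ex pos])
  show nn: "0 \<le> walk_density E w \<alpha> x z" for z
    using d pos \<alpha> by (auto simp: walk_density_def positive_weight_def adj_def
        intro!: divide_nonneg_pos mult_nonneg_nonneg dest: less_imp_le)
  have supp: "walk_density E w \<alpha> x z = 0" if "z \<notin> insert x ?N" for z
    using that by (auto simp: walk_density_def)
  have "(\<integral>\<^sup>+ z. ennreal (walk_density E w \<alpha> x z) \<partial>count_space UNIV)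
      = (\<Sum>z\<in>insert x ?N. ennreal (walk_density E w \<alpha> x z))"
    using fin supp by (intro nn_integral_count_space') auto
  also have "\<dots> = ennreal (\<Sum>z\<in>insert x ?N. walk_density E w \<alpha> x z)"
    using nn by (intro sum_ennreal) auto
  also have "(\<Sum>z\<in>insert x ?N. walk_density E w \<alpha> x z)
      = \<alpha> + (\<Sum>z\<in>?N. (1 - \<alpha>) * w {x, z} / wdeg E w x)"
  proof -
    have "(\<Sum>z\<in>?N. walk_density E w \<alpha> x z) = (\<Sum>z\<in>?N. (1 - \<alpha>) * w {x, z} / wdeg E w x)"
      by (intro sum.cong) (auto simp: walk_density_def not_adj_self)
    moreover have "walk_density E w \<alpha> x x = \<alpha>"
      by (simp add: walk_density_def)
    ultimately show ?thesis
      using fin not_adj_self by simp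
  qed
  also have "\<dots> = 1"
    using d by (simp add: wdeg_def flip: sum_divide_distrib sum_distrib_left)
  finally show "(\<integral>\<^sup>+ z. ennreal (walk_density E w \<alpha> x z) \<partial>count_space UNIV) = 1"
    by simp
qed

end

theory Submission imports Defs begin

text \<open>
  In girth at least 6 the neighbours of an edge \<open>xy\<close> lie at levels \<open>-1, 0, 1, 2\<close> of a potential
  that measures all the relevant distances, so transport is one-dimensional and
  \<open>\<kappa>\<^sub>L\<^sub>L\<^sub>Y(x,y) = 2 (w\<^sub>x\<^sub>y/d\<^sub>x + w\<^sub>x\<^sub>y/d\<^sub>y - 1)\<close>. Summing \<open>w\<^sub>x\<^sub>y/d\<^sub>x + w\<^sub>x\<^sub>y/d\<^sub>y \<ge> 1\<close> over all
  edges gives \<open>|E| \<le> |V|\<close>, and equality forces the graph to be 2-regular. Conversely, a cycle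
  is handled by the constant weight, and a tree by weights that decrease rapidly away from a root.
\<close>

section \<open>Paths, girth and growth of vertex sets in connected graphs\<close>

definition inc_edges :: "'a set set \<Rightarrow> 'a \<Rightarrow> 'a set set" where
  "inc_edges E x = {e \<in> E. x \<in> e}"

lemma adj_commute: "adj E x y \<longleftrightarrow> adj E y x"
  by (simp add: adj_def insert_commute)

lemma length_ge_girth:
  assumes "girth E \<ge> 6" "is_cycle E c"
  shows "6 \<le> length c"
proof -
  have "girth E \<le> enat (length c)"
    unfolding girth_def by (rule INF_lower) (use assms in auto)
  with assms(1) have "enat 6 \<le> enat (length c)" by (metis order_trans numeral_eq_enat)
  then show ?thesis by simp
qed

text \<open>Loop erasure: when the new first vertex already lies on the path, the part of the path
  from that vertex on is kept. The bound on \<open>set p\<close> holds because every vertex but the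
  last has an outgoing step; it later confines the path to a given vertex set.\<close>

lemma rtranclp_imp_distinct_path:
  assumes "r\<^sup>*\<^sup>* x y"
  shows "\<exists>p. p \<noteq> [] \<and> distinct p \<and> hd p = x \<and> last p = y \<and> successively r p
     \<and> set p \<subseteq> insert y {a. \<exists>b. r a b}"
  using assms
proof (induction rule: converse_rtranclp_induct)
  case base
  show ?case by (rule exI[of _ "[y]"]) auto
next
  case (step x z)
  then obtain p where p: "p \<noteq> []" "distinct p" "hd p = z" "last p = y" "successively r p"
    "set p \<subseteq> insert y {a. \<exists>b. r a b}" by auto
  show ?case
  proof (cases "x \<in> set p")
    case True
    then obtain a b where ab: "p = a @ x # b" by (meson split_list)
    have "successively r (x # b)"
      using p(5) unfolding ab by (simp add: successively_append_iff)
    then show ?thesis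
      using p ab by (intro exI[of _ "x # b"]) auto
  next
    case False
    then show ?thesis
      using p step.hyps(1) by (intro exI[of _ "x # p"]) (auto simp: successively_Cons)
  qed
qed

text \<open>Induction by attaching one vertex at a time: as long as \<open>S\<close> is not all of
  \<open>V\<close>, connectedness supplies an edge leaving it. It serves both the edge count from a
  cycle and the construction of tree weights.\<close>

lemma connected_graph_grow:
  assumes fin: "finite V" and con: "connected_graph V E" and S: "S \<subseteq> V" "S \<noteq> {}" and P: "P S"
    and step: "\<And>S u v. S \<subseteq> V \<Longrightarrow> P S \<Longrightarrow> u \<in> S \<Longrightarrow> v \<in> V \<Longrightarrow> v \<notin> S \<Longrightarrow> adj E u v \<Longrightarrow> P (insert v S)"
    and EV: "\<And>u v. adj E u v \<Longrightarrow> v \<in> V"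
  shows "P V"
  using S P
proof (induction "card (V - S)" arbitrary: S rule: less_induct)
  case less
  show ?case
  proof (cases "S = V")
    case True
    then show ?thesis using less by simp
  next
    case False
    then obtain a b where ab: "a \<in> S" "b \<in> V" "b \<notin> S" using less.prems by blast
    have "(adj E)\<^sup>*\<^sup>* a b" using con ab less.prems unfolding connected_graph_def by blast
    moreover have "b \<in> S" if "(adj E)\<^sup>*\<^sup>* a b" "\<forall>u\<in>S. \<forall>v. adj E u v \<longrightarrow> v \<in> S"
      using that by (induction rule: rtranclp_induct) (use ab in auto)
    ultimately obtain u v where uv: "u \<in> S" "v \<notin> S" "adj E u v" using ab by blast
    have "v \<in> V" using EV uv by blast
    moreover have "card (V - insert v S) < card (V - S)"
      using fin uv \<open>v \<in> V\<close> by (intro psubset_card_mono) auto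
    ultimately show ?thesis
      using less.prems uv step[of S u v] by (intro less.hyps[of "insert v S"]) auto
  qed
qed

section \<open>Couplings\<close>

text \<open>A fraction \<open>s\<close> of the mass of \<mu> at \<open>x\<close> stays there and
  covers all of the mass of \<nu> at \<open>x\<close>; everything else is sent independently to
  \<nu> conditioned on avoiding \<open>x\<close>. Thus no mass is moved into \<open>x\<close> from
  elsewhere.\<close>

lemma coupling_into_point:
  assumes le: "pmf \<nu> x \<le> pmf \<mu> x" and lt: "pmf \<nu> x < 1"
  shows "\<exists>\<pi>\<in>couplings \<mu> \<nu>. \<forall>u. (u, x) \<in> set_pmf \<pi> \<longrightarrow> u = x"
proof -
  define \<nu>' where "\<nu>' = cond_pmf \<nu> (- {x})"
  define s where "s = pmf \<nu> x / pmf \<mu> x"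
  have m: "measure \<nu> (- {x}) = 1 - pmf \<nu> x"
    by (simp add: measure_pmf.prob_compl[of "{x}", simplified] Compl_eq_Diff_UNIV measure_pmf_single)
  have ne: "set_pmf \<nu> \<inter> (- {x}) \<noteq> {}"
    using m lt measure_pmf_zero_iff[of \<nu> "- {x}"] by auto
  have \<nu>': "pmf \<nu>' z = (if z = x then 0 else pmf \<nu> z / (1 - pmf \<nu> x))" for z
    unfolding \<nu>'_def by (subst pmf_cond[OF ne]) (simp add: m)
  \<comment> \<open>If \<mu> has no mass at \<open>x\<close>, neither has \<nu>, and division by
    zero gives \<open>s = 0\<close>; the bounds and the product identity below include this
    case.\<close>
  have s01: "0 \<le> s" "s \<le> 1"
    using le pmf_nonneg[of \<mu> x] by (auto simp: s_def divide_le_eq_1)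
  have s\<mu>: "s * pmf \<mu> x = pmf \<nu> x" using le pmf_nonneg[of \<nu> x] by (auto simp: s_def)
  define K where "K u = (if u = x then bernoulli_pmf s \<bind> (\<lambda>b. if b then return_pmf x else \<nu>') else \<nu>')" for u
  define \<pi> where "\<pi> = \<mu> \<bind> (\<lambda>u. map_pmf (Pair u) (K u))"
  have fst: "map_pmf fst \<pi> = \<mu>"
    by (simp add: \<pi>_def map_bind_pmf map_pmf_comp o_def bind_return_pmf' map_pmf_const)
  have "map_pmf snd \<pi> = \<mu> \<bind> K"
    by (simp add: \<pi>_def map_bind_pmf map_pmf_comp o_def)
  also have "\<dots> = \<nu>"
  proof (rule pmf_eqI)
    fix z
    \<comment> \<open>Written as an affine function of the indicator of \<open>x\<close>, the kernel
      integrates against \<mu> to an expression in \<open>pmf \<mu> x\<close> alone.\<close>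
    have K: "pmf (K u) z = pmf \<nu>' z + (s * (indicator {x} z - pmf \<nu>' z)) * indicator {x} u" for u
      using s01 by (auto simp: K_def pmf_bind algebra_simps split: split_indicator)
    have "pmf (\<mu> \<bind> K) z = pmf \<nu>' z + (s * (indicator {x} z - pmf \<nu>' z)) * pmf \<mu> x"
      unfolding pmf_bind K
      by (subst Bochner_Integration.integral_add)
        (auto simp: measure_pmf_single intro: measure_pmf.integrable_const_bound[where B = 1])
    also have "\<dots> = pmf \<nu>' z + pmf \<nu> x * (indicator {x} z - pmf \<nu>' z)"
      by (simp flip: s\<mu>)
    also have "\<dots> = pmf \<nu> z"
      using lt by (auto simp: \<nu>' field_simps)
    finally show "pmf (\<mu> \<bind> K) z = pmf \<nu> z" .
  qed
  finally have snd: "map_pmf snd \<pi> = \<nu>" .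
  have "u = x" if "(u, x) \<in> set_pmf \<pi>" for u
  proof (rule ccontr)
    assume "u \<noteq> x"
    then have "x \<in> set_pmf \<nu>'" using that by (auto simp: \<pi>_def K_def)
    then show False using \<nu>' by (simp add: set_pmf_iff)
  qed
  with fst snd show ?thesis unfolding couplings_def by blast
qed

text \<open>Kantorovich duality for a potential \<open>f\<close> that is tight on the support of some coupling.\<close>

lemma W1_eq_potential:
  fixes f :: "'a \<Rightarrow> real"
  assumes fin: "finite (set_pmf \<mu>)" "finite (set_pmf \<nu>)"
    and lip: "\<And>u v. u \<in> set_pmf \<mu> \<Longrightarrow> v \<in> set_pmf \<nu> \<Longrightarrow> f v - f u \<le> real (graph_dist E u v)"
    and \<pi>: "\<pi> \<in> couplings \<mu> \<nu>"
    and tight: "\<And>u v. (u, v) \<in> set_pmf \<pi> \<Longrightarrow> real (graph_dist E u v) = f v - f u"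
  shows "W1 E \<mu> \<nu> = measure_pmf.expectation \<nu> f - measure_pmf.expectation \<mu> f"
proof -
  let ?c = "measure_pmf.expectation \<nu> f - measure_pmf.expectation \<mu> f"
  let ?d = "\<lambda>(u, v). real (graph_dist E u v)"
  let ?g = "\<lambda>(u, v). f v - f u"
  \<comment> \<open>The expected potential difference depends only on the marginals, so it is the
    same for all couplings.\<close>
  have *: "finite (set_pmf \<rho>)" "set_pmf \<rho> \<subseteq> set_pmf \<mu> \<times> set_pmf \<nu>"
    "measure_pmf.expectation \<rho> ?g = ?c" if "\<rho> \<in> couplings \<mu> \<nu>" for \<rho>
  proof -
    have m: "map_pmf fst \<rho> = \<mu>" "map_pmf snd \<rho> = \<nu>" using that by (auto simp: couplings_def)
    then show sub: "set_pmf \<rho> \<subseteq> set_pmf \<mu> \<times> set_pmf \<nu>" by force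
    then show fr: "finite (set_pmf \<rho>)" using fin by (meson finite_SigmaI finite_subset)
    have "measure_pmf.expectation \<rho> ?g
        = measure_pmf.expectation \<rho> (\<lambda>z. f (snd z)) - measure_pmf.expectation \<rho> (\<lambda>z. f (fst z))"
      unfolding case_prod_beta
      by (intro Bochner_Integration.integral_diff integrable_measure_pmf_finite fr)
    also have "\<dots> = ?c" by (simp flip: m)
    finally show "measure_pmf.expectation \<rho> ?g = ?c" .
  qed
  have lower: "?c \<le> measure_pmf.expectation \<rho> ?d" if "\<rho> \<in> couplings \<mu> \<nu>" for \<rho>
    unfolding *(3)[OF that, symmetric]
    using *(2)[OF that] lip
    by (intro integral_mono_AE integrable_measure_pmf_finite *(1)[OF that])
      (auto simp: AE_measure_pmf_iff)
  moreover have "measure_pmf.expectation \<pi> ?d = ?c"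
    unfolding *(3)[OF \<pi>, symmetric]
    by (intro integral_cong_AE) (auto simp: AE_measure_pmf_iff tight)
  ultimately show ?thesis
    unfolding W1_def using \<pi> by (intro cInf_eq_minimum) (auto intro: rev_image_eqI)
qed

section \<open>Curvature of an edge in girth at least six\<close>

context simple_graph
begin

lemma adj_neq: "adj E x y \<Longrightarrow> x \<noteq> y"
  using not_adj_self by blast

lemma adj_in_V: "adj E x y \<Longrightarrow> x \<in> V" "adj E x y \<Longrightarrow> y \<in> V"
  using edge_subset by (auto simp: adj_def)

section \<open>Closed walks of length at most five, and distances up to three\<close>

lemma no_closed_walk3:
  assumes "girth E \<ge> 6" "adj E a b" "adj E b c" "adj E c a"
  shows False
proof -
  have "is_cycle E [a, b, c]"
    using assms adj_neq by (auto simp: is_cycle_def)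
  from length_ge_girth[OF assms(1) this] show False by simp
qed

text \<open>A closed walk of length four can backtrack, so distinct opposite vertices must be
  assumed; for lengths three and five this is automatic.\<close>

lemma no_cycle4:
  assumes "girth E \<ge> 6" "adj E a b" "adj E b c" "adj E c d" "adj E d a" "a \<noteq> c" "b \<noteq> d"
  shows False
proof -
  have "is_cycle E [a, b, c, d]"
    using assms adj_neq by (auto simp: is_cycle_def)
  from length_ge_girth[OF assms(1) this] show False by simp
qed

text \<open>A repeated vertex would split off a closed walk of length three, so all five vertices
  are distinct.\<close>

lemma no_closed_walk5:
  assumes "girth E \<ge> 6" "adj E a b" "adj E b c" "adj E c d" "adj E d e" "adj E e a"
  shows False
proof -
  note T = no_closed_walk3[OF assms(1)]
  have "is_cycle E [a, b, c, d, e]"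
    using assms(2-) adj_neq T by (auto simp: is_cycle_def)
  from length_ge_girth[OF assms(1) this] show False by simp
qed

lemma graph_dist_self: "graph_dist E x x = 0"
  unfolding graph_dist_def by (rule Least_equality) auto

lemma graph_dist_eqI:
  assumes "(adj E ^^ n) x y" "\<And>m. m < n \<Longrightarrow> \<not> (adj E ^^ m) x y"
  shows "graph_dist E x y = n"
  unfolding graph_dist_def using assms by (intro Least_equality) (auto simp: not_less[symmetric])

lemma graph_dist_adj: "adj E x y \<Longrightarrow> graph_dist E x y = 1"
  using adj_neq by (intro graph_dist_eqI) auto

lemma graph_dist_2:
  assumes "girth E \<ge> 6" "adj E a b" "adj E b c" "a \<noteq> c"
  shows "graph_dist E a c = 2"
proof (rule graph_dist_eqI)
  show "(adj E ^^ 2) a c" using assms by (auto simp: numeral_eq_Suc)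
  have "\<not> adj E a c" using no_closed_walk3[OF assms(1-3)] adj_commute by metis
  then show "\<not> (adj E ^^ m) a c" if "m < 2" for m
    using that assms(4) by (auto simp: less_Suc_eq numeral_eq_Suc)
qed

text \<open>A shorter walk from \<open>a\<close> to \<open>d\<close> would close the given
  non-backtracking walk up to length three, four or five.\<close>

lemma graph_dist_3:
  assumes "girth E \<ge> 6" "adj E a b" "adj E b c" "adj E c d" "a \<noteq> c" "b \<noteq> d"
  shows "graph_dist E a d = 3"
proof (rule graph_dist_eqI)
  show "(adj E ^^ 3) a d" using assms by (auto simp: numeral_eq_Suc)
  have 0: "a \<noteq> d" using no_closed_walk3[OF assms(1-3)] assms(4) by metis
  have 1: "\<not> adj E a d" using no_cycle4[OF assms(1-4) _ assms(5,6)] adj_commute by metis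
  have 2: "\<not> (adj E a m \<and> adj E m d)" for m
    using no_closed_walk5[OF assms(1-4), of m] adj_commute by metis
  show "\<not> (adj E ^^ m) a d" if "m < 3" for m
    using that 0 1 2 by (auto simp: less_Suc_eq numeral_eq_Suc)
qed

lemma wdeg_eq_inc: "wdeg E w x = (\<Sum>e\<in>inc_edges E x. w e)"
  unfolding wdeg_def
proof (rule sum.reindex_bij_betw)
  show "bij_betw (\<lambda>y. {x, y}) {y. adj E x y} (inc_edges E x)"
    unfolding bij_betw_def
  proof
    show "inj_on (\<lambda>y. {x, y}) {y. adj E x y}" by (auto simp: inj_on_def doubleton_eq_iff)
    show "(\<lambda>y. {x, y}) ` {y. adj E x y} = inc_edges E x"
    proof (intro equalityI subsetI)
      fix e assume e: "e \<in> inc_edges E x"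
      then obtain a b where "e = {a, b}" using edge_card[of e] by (auto simp: inc_edges_def card_2_iff)
      with e have "e = {x, if x = a then b else a}" by (auto simp: inc_edges_def)
      with e show "e \<in> (\<lambda>y. {x, y}) ` {y. adj E x y}"
        by (auto simp: inc_edges_def adj_def)
    qed (auto simp: adj_def inc_edges_def)
  qed
qed

text \<open>The bound \<alpha> \<ge> 1/2 makes the measure at \<open>x\<close> lazy enough to cover
  by itself the mass that the measure at \<open>y\<close> puts on \<open>x\<close>. The result is
  linear in 1 - \<alpha>, which makes the later limit trivial.\<close>

lemma kappa_eq:
  assumes fin: "finite V" and g: "girth E \<ge> 6" and pos: "positive_weight E w" and xy: "adj E x y"
    and \<alpha>: "1/2 \<le> \<alpha>" "\<alpha> < 1"
  shows "kappa E w \<alpha> x y = (1 - \<alpha>) * (2 * (w {x, y} / wdeg E w x + w {x, y} / wdeg E w y - 1))"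
proof -
  have finN: "finite {b. adj E a b}" for a
    using finite_subset[OF _ fin] adj_in_V by (metis mem_Collect_eq subsetI)
  have yx: "adj E y x" using xy adj_commute by metis
  have ne: "x \<noteq> y" using xy adj_neq by blast
  let ?\<mu> = "walk_measure E w \<alpha> x" and ?\<nu> = "walk_measure E w \<alpha> y"
  have \<mu>: "pmf ?\<mu> z = walk_density E w \<alpha> x z" for z
    using \<alpha> by (intro pmf_walk_measure[OF finN xy pos]) auto
  have \<nu>: "pmf ?\<nu> z = walk_density E w \<alpha> y z" for z
    using \<alpha> by (intro pmf_walk_measure[OF finN yx pos]) auto
  have S\<mu>: "set_pmf ?\<mu> \<subseteq> insert x {b. adj E x b}"
    by (auto simp: set_pmf_iff \<mu> walk_density_def split: if_splits)
  have S\<nu>: "set_pmf ?\<nu> \<subseteq> insert y {b. adj E y b}"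
    by (auto simp: set_pmf_iff \<nu> walk_density_def split: if_splits)
  have dx: "wdeg E w x > 0" and dy: "wdeg E w y > 0"
    using wdeg_pos[OF finN xy pos] wdeg_pos[OF finN yx pos] by auto
  \<comment> \<open>The levels follow a path: other neighbours of \<open>x\<close>, then
    \<open>x\<close>, \<open>y\<close>, and other neighbours of \<open>y\<close>. The default value
    2 is for the last group, which the absence of triangles keeps out of the -1 branch.\<close>
  define f :: "'a \<Rightarrow> real"
    where "f z = (if z = x then 0 else if z = y then 1 else if adj E x z then -1 else 2)" for z
  \<comment> \<open>The excluded pair \<open>u = y\<close>, \<open>v = x\<close> is the one where
    the potential drops, by 1, although the distance is 1. The coupling must avoid it.\<close>
  have dist: "real (graph_dist E u v) = f v - f u"
    if u: "u = x \<or> adj E x u" and v: "v = y \<or> adj E y v" and nxy: "v = x \<longrightarrow> u \<noteq> y" for u v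
  proof -
    have fv: "f v = 2" if "v \<noteq> x" "v \<noteq> y"
      using that v no_closed_walk3[OF g xy, of v] adj_commute[of E x v] by (auto simp: f_def)
    have fu: "f u = -1" if "u \<noteq> x" "u \<noteq> y"
      using that u by (auto simp: f_def)
    have fxy: "f x = 0" "f y = 1" using ne by (auto simp: f_def)
    have ux: "adj E u x" if "u \<noteq> x" using u that adj_commute by metis
    have yv: "adj E y v" if "v \<noteq> y" using v that by metis
    consider "u = x" "v = x" | "u = x" "v = y" | "u = x" "v \<noteq> x" "v \<noteq> y"
      | "u = y" "v = y" | "u = y" "v \<noteq> x" "v \<noteq> y"
      | "u \<noteq> x" "u \<noteq> y" "v = x" | "u \<noteq> x" "u \<noteq> y" "v = y" | "u \<noteq> x" "u \<noteq> y" "v \<noteq> x" "v \<noteq> y"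
      using nxy by blast
    then show ?thesis
    proof cases
      case 3
      then show ?thesis using graph_dist_2[OF g xy yv] fv fxy by auto
    next
      case 7
      then show ?thesis using graph_dist_2[OF g ux xy] fu fxy by auto
    next
      case 8
      then show ?thesis using graph_dist_3[OF g ux xy yv] fu fv by auto
    qed (use xy yv ux fu fv fxy graph_dist_self graph_dist_adj in auto)
  qed
  have le: "w {x, y} \<le> wdeg E w a" if "adj E a b" "{a, b} = {x, y}" for a b
  proof -
    have "w {a, b} \<le> wdeg E w a"
      unfolding wdeg_def
    proof (rule member_le_sum[of b _ "\<lambda>b. w {a, b}"])
      show "finite {b. adj E a b}" by (rule finN)
    qed (use that pos in \<open>auto simp: positive_weight_def adj_def less_imp_le\<close>)
    then show ?thesis using that by simp
  qed
  have ley: "w {x, y} / wdeg E w y \<le> 1" using le[OF yx] dy by (simp add: insert_commute)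
  have pny: "pmf ?\<nu> x = (1 - \<alpha>) * (w {x, y} / wdeg E w y)"
    using ne yx by (simp add: \<nu> walk_density_def insert_commute)
  \<comment> \<open>Together with \<alpha> \<ge> 1 - \<alpha> this shows that the mass at
    \<open>x\<close> does not increase, as \<open>coupling_into_point\<close> requires.\<close>
  have b: "pmf ?\<nu> x \<le> 1 - \<alpha>"
    unfolding pny using ley \<alpha> by (intro mult_left_le) auto
  have pmx: "pmf ?\<mu> x = \<alpha>" by (simp add: \<mu> walk_density_def)
  obtain \<pi> where \<pi>: "\<pi> \<in> couplings ?\<mu> ?\<nu>" "\<And>u. (u, x) \<in> set_pmf \<pi> \<Longrightarrow> u = x"
    using coupling_into_point[of ?\<nu> x ?\<mu>] b pmx \<alpha> by auto
  have sub: "u \<in> set_pmf ?\<mu>" "v \<in> set_pmf ?\<nu>" if "(u, v) \<in> set_pmf \<pi>" for u v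
    using \<pi>(1) imageI[OF that, of fst] imageI[OF that, of snd]
    by (auto simp: couplings_def simp flip: set_map_pmf)
  have "W1 E ?\<mu> ?\<nu> = measure_pmf.expectation ?\<nu> f - measure_pmf.expectation ?\<mu> f"
  proof (rule W1_eq_potential[OF _ _ _ \<pi>(1)])
    show "finite (set_pmf ?\<mu>)" "finite (set_pmf ?\<nu>)"
      using S\<mu> S\<nu> finN by (meson finite_insert finite_subset)+
    show "f v - f u \<le> real (graph_dist E u v)" if "u \<in> set_pmf ?\<mu>" "v \<in> set_pmf ?\<nu>" for u v
    proof (cases "v = x \<and> u = y")
      case True
      then show ?thesis using ne by (simp add: f_def)
    next
      case False
      then have "real (graph_dist E u v) = f v - f u" using that S\<mu> S\<nu> by (intro dist) auto
      then show ?thesis by simp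
    qed
    show "real (graph_dist E u v) = f v - f u" if "(u, v) \<in> set_pmf \<pi>" for u v
      using sub[OF that] S\<mu> S\<nu> that \<pi>(2)[of u] ne by (intro dist) auto
  qed
  also have "measure_pmf.expectation ?\<mu> f = (1 - \<alpha>) * (2 * (w {x, y} / wdeg E w x) - 1)"
  proof -
    have "measure_pmf.expectation ?\<mu> f = (\<Sum>z\<in>insert x {b. adj E x b}. pmf ?\<mu> z * f z)"
      using S\<mu> finN by (subst integral_measure_pmf_real[of "insert x {b. adj E x b}"]) (auto simp: mult.commute)
    also have "\<dots> = (\<Sum>z\<in>{b. adj E x b}. pmf ?\<mu> z * f z)"
      using finN not_adj_self by (simp add: f_def)
    \<comment> \<open>Each neighbour has level -1 except \<open>y\<close> at level 1; the term
      \<open>2 * w {x, y}\<close> corrects for \<open>y\<close>.\<close>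
    also have "\<dots> = (\<Sum>z\<in>{b. adj E x b}. (1 - \<alpha>) / wdeg E w x * ((if z = y then 2 * w {x, y} else 0) - w {x, z}))"
      using not_adj_self by (intro sum.cong) (auto simp: \<mu> walk_density_def f_def)
    also have "\<dots> = (1 - \<alpha>) / wdeg E w x * (2 * w {x, y} - wdeg E w x)"
      unfolding sum_distrib_left[symmetric] sum_subtractf wdeg_def using xy finN by simp
    finally show ?thesis using dx by (simp add: field_simps)
  qed
  also have "measure_pmf.expectation ?\<nu> f = \<alpha> + (1 - \<alpha>) * (2 - 2 * (w {x, y} / wdeg E w y))"
  proof -
    have "measure_pmf.expectation ?\<nu> f = (\<Sum>z\<in>insert y {b. adj E y b}. pmf ?\<nu> z * f z)"
      using S\<nu> finN by (subst integral_measure_pmf_real[of "insert y {b. adj E y b}"]) (auto simp: mult.commute)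
    also have "\<dots> = \<alpha> + (\<Sum>z\<in>{b. adj E y b}. pmf ?\<nu> z * f z)"
      using finN not_adj_self ne by (simp add: f_def \<nu> walk_density_def)
    \<comment> \<open>Each neighbour has level 2 except \<open>x\<close> at level 0, which the
      subtracted term corrects.\<close>
    also have "(\<Sum>z\<in>{b. adj E y b}. pmf ?\<nu> z * f z)
      = (\<Sum>z\<in>{b. adj E y b}. (1 - \<alpha>) / wdeg E w y * (2 * w {y, z} - (if z = x then 2 * w {x, y} else 0)))"
    proof (intro sum.cong refl)
      fix z assume "z \<in> {b. adj E y b}"
      then have z: "adj E y z" by simp
      then have "\<not> adj E x z" "z \<noteq> y"
        using no_closed_walk3[OF g xy, of z] adj_commute[of E x z] not_adj_self by auto
      with z show "pmf ?\<nu> z * f z = (1 - \<alpha>) / wdeg E w y * (2 * w {y, z} - (if z = x then 2 * w {x, y} else 0))"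
        using ne by (auto simp: \<nu> walk_density_def f_def insert_commute)
    qed
    also have "\<dots> = (1 - \<alpha>) / wdeg E w y * (2 * wdeg E w y - 2 * w {x, y})"
      unfolding sum_distrib_left[symmetric] sum_subtractf wdeg_def using yx finN by simp
    finally show ?thesis using dy by (simp add: field_simps)
  qed
  finally show ?thesis unfolding kappa_def by (simp add: algebra_simps)
qed

text \<open>For \<alpha> between 1/2 and 1 the quotient no longer depends on \<alpha>, so the limit
  exists and is that constant.\<close>

lemma kappa_LLY_eq:
  assumes "finite V" "girth E \<ge> 6" "positive_weight E w" "adj E x y"
  shows "kappa_LLY E w x y = 2 * (w {x, y} / wdeg E w x + w {x, y} / wdeg E w y - 1)"
  unfolding kappa_LLY_def
proof (rule tendsto_Lim)
  have "eventually (\<lambda>\<alpha>::real. \<alpha> \<in> {1/2<..<1}) (at_left 1)"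
    by (rule eventually_at_left_real) simp
  then have "eventually (\<lambda>\<alpha>. kappa E w \<alpha> x y / (1 - \<alpha>)
      = 2 * (w {x, y} / wdeg E w x + w {x, y} / wdeg E w y - 1)) (at_left 1)"
    by eventually_elim (simp add: kappa_eq[OF assms])
  then show "((\<lambda>\<alpha>. kappa E w \<alpha> x y / (1 - \<alpha>)) \<longlongrightarrow>
      2 * (w {x, y} / wdeg E w x + w {x, y} / wdeg E w y - 1)) (at_left 1)"
    by (rule tendsto_eventually)
qed simp

text \<open>The two endpoint ratios form one sum over \<open>e\<close>, ready to be summed over all
  edges with the order of summation exchanged.\<close>

lemma admissible_iff:
  assumes "finite V" "girth E \<ge> 6"
  shows "admissible E w \<longleftrightarrow> positive_weight E w \<and> (\<forall>e\<in>E. 1 \<le> (\<Sum>x\<in>e. w e / wdeg E w x))"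
proof (cases "positive_weight E w")
  case True
  have "(\<forall>x y. adj E x y \<longrightarrow> kappa_LLY E w x y \<ge> 0) \<longleftrightarrow> (\<forall>x y. adj E x y \<longrightarrow> 1 \<le> (\<Sum>a\<in>{x, y}. w {x, y} / wdeg E w a))"
    using adj_neq by (intro all_cong1 imp_cong refl) (auto simp: kappa_LLY_eq[OF assms True])
  also have "\<dots> \<longleftrightarrow> (\<forall>e\<in>E. 1 \<le> (\<Sum>x\<in>e. w e / wdeg E w x))"
    using edge_card by (auto simp: adj_def) (metis card_2_iff)
  finally show ?thesis using True by (simp add: admissible_def)
qed (simp add: admissible_def)

section \<open>Counting edges\<close>

lemma finite_E: "finite V \<Longrightarrow> finite E"
  using edge_subset by (meson PowI finite_Pow_iff finite_subset subsetI)

lemma sum_edges_swap: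
  assumes "finite V"
  shows "(\<Sum>e\<in>E. \<Sum>x\<in>e. g x e) = (\<Sum>x\<in>V. \<Sum>e\<in>inc_edges E x. g x e)"
proof -
  have "(\<Sum>e\<in>E. \<Sum>x\<in>e. g x e) = (\<Sum>e\<in>E. \<Sum>x\<in>{x \<in> V. x \<in> e}. g x e)"
    using edge_subset by (intro sum.cong) auto
  also have "\<dots> = (\<Sum>x\<in>V. \<Sum>e\<in>inc_edges E x. g x e)"
    unfolding inc_edges_def by (rule sum.swap_restrict) (use assms finite_E in auto)
  finally show ?thesis .
qed

lemma inc_edges_nonempty:
  assumes "connected_graph V E" "E \<noteq> {}" "x \<in> V"
  shows "inc_edges E x \<noteq> {}"
proof -
  obtain e where e: "e \<in> E" using assms by auto
  then obtain a b where ab: "e = {a, b}" "a \<noteq> b" using edge_card by (metis card_2_iff)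
  then obtain y where y: "y \<in> V" "y \<noteq> x" using e edge_subset[of e] by (metis insert_subset)
  then have "(adj E)\<^sup>*\<^sup>* x y" using assms by (auto simp: connected_graph_def)
  then obtain z where "adj E x z" using y by (auto elim: converse_rtranclpE)
  then show ?thesis by (auto simp: adj_def inc_edges_def)
qed

lemma wdeg_pos_inc:
  assumes "finite E" "positive_weight E w" "inc_edges E x \<noteq> {}"
  shows "wdeg E w x > 0"
  unfolding wdeg_eq_inc using assms
  by (intro sum_pos) (auto simp: inc_edges_def positive_weight_def)

text \<open>Grouped by vertices, the ratios at a vertex are the transition probabilities of a random
  walk and sum to 1. Connectedness and the presence of an edge exclude isolated vertices, where the
  empty sum would be 0.\<close>

lemma sum_edge_ratios:
  assumes "finite V" "connected_graph V E" "E \<noteq> {}" "positive_weight E w"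
  shows "(\<Sum>e\<in>E. \<Sum>x\<in>e. w e / wdeg E w x) = real (card V)"
proof -
  have "(\<Sum>e\<in>inc_edges E x. w e / wdeg E w x) = 1" if "x \<in> V" for x
    using wdeg_pos_inc[of w x] inc_edges_nonempty[of x] assms finite_E that
    by (simp add: wdeg_eq_inc flip: sum_divide_distrib)
  then show ?thesis by (subst sum_edges_swap) (use assms in auto)
qed

lemma admissible_card_le:
  assumes "finite V" "connected_graph V E" "E \<noteq> {}" "girth E \<ge> 6" "admissible E w"
  shows "card E \<le> card V"
proof -
  have "real (card E) = (\<Sum>e\<in>E. 1)" by simp
  also have "\<dots> \<le> (\<Sum>e\<in>E. \<Sum>x\<in>e. w e / wdeg E w x)"
    using assms admissible_iff by (intro sum_mono) auto
  also have "\<dots> = card V" using assms by (intro sum_edge_ratios) (auto simp: admissible_def)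
  finally show ?thesis by simp
qed

text \<open>
  If \<open>|E| = |V|\<close>, the curvature inequality is an equality on every edge. A pendant edge
  would violate it, so all degrees are at least two, hence equal to the average degree two.
\<close>

lemma admissible_imp_two_regular:
  assumes fin: "finite V" and con: "connected_graph V E" and ne: "E \<noteq> {}" and g: "girth E \<ge> 6"
    and adm: "admissible E w" and eq: "card E = card V" and x: "x \<in> V"
  shows "card (inc_edges E x) = 2"
proof -
  have pos: "positive_weight E w" using adm by (simp add: admissible_def)
  have finI: "finite (inc_edges E a)" for a using finite_E[OF fin] by (simp add: inc_edges_def)
  have tight: "(\<Sum>x\<in>e. w e / wdeg E w x) = 1" if "e \<in> E" for e
  proof (rule sym, rule sum_mono_inv[where I = E])
    show "(\<Sum>e\<in>E. 1) = (\<Sum>e\<in>E. \<Sum>x\<in>e. w e / wdeg E w x)"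
      using sum_edge_ratios[OF fin con ne pos] eq by simp
  qed (use that finite_E[OF fin] adm admissible_iff[OF fin g] in auto)
  have ge: "2 \<le> card (inc_edges E a)" if a: "a \<in> V" for a
  proof (rule ccontr)
    assume "\<not> ?thesis"
    then have "card (inc_edges E a) = 1"
      using inc_edges_nonempty[OF con ne a] finI[of a] card_gt_0_iff[of "inc_edges E a"] by linarith
    then obtain e where e: "inc_edges E a = {e}" by (auto simp: card_1_singleton_iff)
    then have eE: "e \<in> E" "a \<in> e" by (auto simp: inc_edges_def)
    then obtain b where b: "e = {a, b}" "b \<noteq> a"
      using edge_card[of e] by (auto simp: card_2_iff)
    have bV: "b \<in> V" using b eE edge_subset by blast
    have "w e > 0" using pos eE by (simp add: positive_weight_def)
    moreover have "wdeg E w b > 0"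
      using wdeg_pos_inc[OF finite_E[OF fin] pos inc_edges_nonempty[OF con ne bV]] .
    \<comment> \<open>The ratio at the leaf is exactly 1 and the one at \<open>b\<close> is
      positive, so the sum exceeds 1.\<close>
    moreover have "wdeg E w a = w e" by (simp add: wdeg_eq_inc e)
    ultimately show False using tight[OF eE(1)] b by (auto simp: field_simps)
  qed
  have "(\<Sum>x\<in>V. card (inc_edges E x)) = (\<Sum>e\<in>E. \<Sum>x\<in>e. 1)"
    by (subst sum_edges_swap[OF fin]) simp
  also have "\<dots> = (\<Sum>x\<in>V. 2)" using edge_card eq by simp
  finally show ?thesis
    using sum_mono_inv[of "\<lambda>_. 2" V "\<lambda>x. card (inc_edges E x)" x] ge fin x by simp
qed

section \<open>Cycles\<close>

text \<open>Length at least three matters: on two vertices both indices would give the same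
  pair.\<close>

lemma cycle_edge_eq_iff:
  assumes "distinct c" "length c \<ge> 3" "i < length c" "j < length c"
    "{c ! i, c ! (Suc i mod length c)} = {c ! j, c ! (Suc j mod length c)}"
  shows "i = j"
proof -
  have "Suc i mod length c < length c" "Suc j mod length c < length c"
    using assms(2) by (auto intro: mod_less_divisor)
  then show ?thesis
    using assms by (auto simp: doubleton_eq_iff nth_eq_iff_index_eq mod_Suc split: if_splits)
qed

lemma is_cycle_edge:
  assumes "is_cycle E c" "i < length c"
  shows "{c ! i, c ! (Suc i mod length c)} \<in> E"
proof (cases "Suc i = length c")
  case True
  have "c \<noteq> []" using assms(2) by auto
  then have "last c = c ! i" "hd c = c ! 0"
    using True by (auto simp: last_conv_nth hd_conv_nth simp flip: True)
  then show ?thesis using assms True by (auto simp: is_cycle_def adj_def)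
next
  case False
  then show ?thesis using assms by (auto simp: is_cycle_def adj_def successively_conv_nth)
qed

lemma is_cycle_subset:
  assumes "is_cycle E c" shows "set c \<subseteq> V"
  using is_cycle_edge[OF assms] edge_subset by (fastforce simp: in_set_conv_nth)

text \<open>The two cycle edges at a vertex of \<open>c\<close> exhaust its degree, so no edge
  leaves the cycle, and by connectedness the cycle is the whole graph.\<close>

lemma two_regular_is_cycle_graph:
  assumes con: "connected_graph V E" and c: "is_cycle E c"
    and deg: "\<And>x. x \<in> V \<Longrightarrow> card (inc_edges E x) = 2"
  shows "is_cycle_graph (length c) V E"
proof -
  define n where "n = length c"
  define ed where "ed i = {c ! i, c ! (Suc i mod n)}" for i
  have n: "n \<ge> 3" and dc: "distinct c" using c by (auto simp: is_cycle_def n_def)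
  have edE: "ed i \<in> E" if "i < n" for i
    using is_cycle_edge[OF c] that by (simp add: ed_def n_def)
  have ed_inj: "i = j" if "ed i = ed j" "i < n" "j < n" for i j
    using cycle_edge_eq_iff[OF dc] n that by (simp add: ed_def n_def)
  have inc: "\<exists>k<n. e = ed k" if e: "e \<in> inc_edges E (c ! i)" and i: "i < n" for e i
  proof -
    \<comment> \<open>The cyclic predecessor of \<open>i\<close>.\<close>
    define j where "j = (if i = 0 then n - 1 else i - 1)"
    have j: "j < n" "j \<noteq> i" "Suc j mod n = i" using i n by (auto simp: j_def)
    have "{ed i, ed j} \<subseteq> inc_edges E (c ! i)"
      using edE i j by (auto simp: inc_edges_def ed_def)
    moreover have "card {ed i, ed j} = 2" using ed_inj[of i j] i j by (auto simp: card_insert_if)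
    moreover have "card (inc_edges E (c ! i)) = 2"
      using is_cycle_subset[OF c] i by (intro deg) (auto simp: n_def)
    ultimately have "inc_edges E (c ! i) = {ed i, ed j}"
      by (metis card_subset_eq card.infinite zero_neq_numeral)
    then show ?thesis using e i j by auto
  qed
  have closed: "y \<in> set c" if "adj E x y" "x \<in> set c" for x y
  proof -
    obtain i where i: "i < n" "x = c ! i" using \<open>x \<in> set c\<close> by (auto simp: in_set_conv_nth n_def)
    have "{x, y} \<in> inc_edges E x" using that by (auto simp: inc_edges_def adj_def)
    then obtain k where "k < n" "{x, y} = ed k" using inc i by blast
    moreover have "Suc k mod n < n" using n by (intro mod_less_divisor) simp
    ultimately have "y \<in> ed k" "ed k \<subseteq> set c" by (auto simp: ed_def n_def)
    then show ?thesis by blast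
  qed
  have V: "V = set c"
  proof
    show "V \<subseteq> set c"
    proof
      fix y assume "y \<in> V"
      moreover have "hd c \<in> set c" using n by (intro hd_in_set) (auto simp: n_def)
      ultimately have "(adj E)\<^sup>*\<^sup>* (hd c) y"
        using con is_cycle_subset[OF c] by (auto simp: connected_graph_def)
      then show "y \<in> set c"
        by (induction rule: rtranclp_induct) (use closed \<open>hd c \<in> set c\<close> in auto)
    qed
  qed (rule is_cycle_subset[OF c])
  have E: "E = ed ` {0..<n}"
  proof
    show "E \<subseteq> ed ` {0..<n}"
    proof
      fix e assume e: "e \<in> E"
      then obtain x where x: "x \<in> e" using edge_card by fastforce
      then obtain i where i: "i < n" "x = c ! i"
        using V e edge_subset by (metis in_set_conv_nth n_def subsetD)
      have "e \<in> inc_edges E (c ! i)" using e x i by (simp add: inc_edges_def)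
      then show "e \<in> ed ` {0..<n}" using inc i by force
    qed
  qed (use edE in auto)
  have bij: "bij_betw (nth c) {0..<n} V"
    using bij_betw_nth[OF dc, of "{..<n}" V] V by (auto simp: n_def atLeast0LessThan)
  \<comment> \<open>The isomorphism sends a vertex to its position on the cycle.\<close>
  define f where "f = inv_into {0..<n} (nth c)"
  have f: "f (c ! i) = i" if "i < n" for i
    unfolding f_def using bij that by (intro inv_into_f_f) (auto simp: bij_betw_def)
  have "(\<lambda>e. f ` e) ` E = cycle_edges n"
    unfolding E cycle_edges_def image_image
    by (intro image_cong) (use n f in \<open>auto simp: ed_def\<close>)
  moreover have "bij_betw f V (cycle_verts n)"
    unfolding f_def cycle_verts_def by (rule bij_betw_inv_into[OF bij])
  ultimately show ?thesis
    unfolding is_cycle_graph_def graph_iso_def n_def by blast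
qed

text \<open>An edge meets a vertex only if it is indexed by the position of the vertex or by the
  cyclic predecessor. An upper bound suffices, as a smaller degree only raises the ratios for the
  constant weight.\<close>

lemma is_cycle_graph_degree_le:
  assumes cy: "is_cycle_graph n V E" and n: "n > 0" and x: "x \<in> V"
  shows "card (inc_edges E x) \<le> 2"
proof -
  obtain f where f: "bij_betw f V {0..<n}" and E: "(\<lambda>e. f ` e) ` E = cycle_edges n"
    using cy by (auto simp: is_cycle_graph_def graph_iso_def cycle_verts_def)
  define j where "j = (if f x = 0 then n - 1 else f x - 1)"
  have fx: "f x < n" using f x by (auto simp: bij_betw_def)
  have "(\<lambda>e. f ` e) ` inc_edges E x \<subseteq> {{f x, Suc (f x) mod n}, {j, Suc j mod n}}"
  proof (rule image_subsetI)
    fix e assume e: "e \<in> inc_edges E x"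
    then have "f ` e \<in> cycle_edges n" "f x \<in> f ` e" using E by (auto simp: inc_edges_def)
    then obtain i where i: "i < n" "f ` e = {i, Suc i mod n}" by (auto simp: cycle_edges_def)
    with \<open>f x \<in> f ` e\<close> have "f x = i \<or> f x = Suc i mod n" by auto
    moreover have "i = j" if "f x = Suc i mod n"
      using that i by (auto simp: j_def mod_Suc split: if_splits)
    ultimately show "f ` e \<in> {{f x, Suc (f x) mod n}, {j, Suc j mod n}}" using i by auto
  qed
  moreover have "inj_on (\<lambda>e. f ` e) (inc_edges E x)"
    using f edge_subset inj_on_image_Pow[of f V]
    by (auto simp: bij_betw_def inc_edges_def intro: inj_on_subset)
  ultimately have "card (inc_edges E x) \<le> card {{f x, Suc (f x) mod n}, {j, Suc j mod n}}"
    by (intro card_inj_on_le) auto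
  also have "\<dots> \<le> 2" by (simp add: card_insert_if)
  finally show ?thesis .
qed

text \<open>With constant weight each endpoint ratio is the reciprocal of a degree, hence at least
  1/2.\<close>

lemma cycle_graph_admissible:
  assumes fin: "finite V" and con: "connected_graph V E" and g: "girth E \<ge> 6"
    and cy: "is_cycle_graph n V E" and n: "n > 0"
  shows "admissible E (\<lambda>_. 1)"
  unfolding admissible_iff[OF fin g]
proof (intro conjI ballI)
  show pos: "positive_weight E (\<lambda>_. 1)" by (simp add: positive_weight_def)
  fix e assume e: "e \<in> E"
  have "1 / 2 \<le> 1 / wdeg E (\<lambda>_. 1) x" if "x \<in> e" for x
  proof (rule divide_left_mono)
    have x: "x \<in> V" using e that edge_subset by blast
    show "wdeg E (\<lambda>_. 1) x \<le> 2" using is_cycle_graph_degree_le[OF cy n x] by (simp add: wdeg_eq_inc)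
    have "wdeg E (\<lambda>_. 1) x > 0"
      using wdeg_pos_inc[OF finite_E[OF fin] pos inc_edges_nonempty[OF con _ x]] e by auto
    then show "0 < 2 * wdeg E (\<lambda>_. 1) x" by simp
  qed simp
  then have "(\<Sum>x\<in>e. 1 / 2) \<le> (\<Sum>x\<in>e. 1 / wdeg E (\<lambda>_. 1) x)" by (intro sum_mono)
  then show "1 \<le> (\<Sum>x\<in>e. 1 / wdeg E (\<lambda>_. 1) x)" using edge_card[OF e] by simp
qed

text \<open>The cycle has at least as many edges as vertices, and every vertex attached afterwards
  brings at least one new edge.\<close>

lemma card_le_if_cycle:
  assumes fin: "finite V" and con: "connected_graph V E" and c: "is_cycle E c"
  shows "card V \<le> card E"
proof -
  have fE: "finite {e \<in> E. Q e}" for Q using finite_E[OF fin] by simp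
  have "card V \<le> card {e \<in> E. e \<subseteq> V}"
  proof (rule connected_graph_grow[OF fin con is_cycle_subset[OF c]])
    have len: "length c \<ge> 3" "distinct c" using c by (auto simp: is_cycle_def)
    then show "set c \<noteq> {}" by auto
    have "card {0..<length c} \<le> card {e \<in> E. e \<subseteq> set c}"
    proof (rule card_inj_on_le[OF _ _ fE])
      show "inj_on (\<lambda>i. {c ! i, c ! (Suc i mod length c)}) {0..<length c}"
        using cycle_edge_eq_iff[OF len(2,1)] by (auto simp: inj_on_def)
      show "(\<lambda>i. {c ! i, c ! (Suc i mod length c)}) ` {0..<length c} \<subseteq> {e \<in> E. e \<subseteq> set c}"
        using is_cycle_edge[OF c] len by (auto intro!: nth_mem mod_less_divisor)
    qed
    then show "card (set c) \<le> card {e \<in> E. e \<subseteq> set c}" using len by (simp add: distinct_card)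
  next
    fix S u v
    assume *: "S \<subseteq> V" "card S \<le> card {e \<in> E. e \<subseteq> S}" "u \<in> S" "v \<in> V" "v \<notin> S" "adj E u v"
    have "card (insert v S) = Suc (card S)"
      using * fin by (simp add: finite_subset)
    also have "\<dots> \<le> card (insert {u, v} {e \<in> E. e \<subseteq> S})"
      using * fE by simp
    also have "\<dots> \<le> card {e \<in> E. e \<subseteq> insert v S}"
      using * by (intro card_mono fE) (auto simp: adj_def)
    finally show "card (insert v S) \<le> card {e \<in> E. e \<subseteq> insert v S}" .
  qed (rule adj_in_V)
  also have "{e \<in> E. e \<subseteq> V} = E" using edge_subset by auto
  finally show ?thesis .
qed

section \<open>Trees\<close>

text \<open>Two edges from \<open>v\<close> into \<open>S\<close>, joined by a path inside
  \<open>S\<close>, would close a cycle through \<open>v\<close>.\<close>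

lemma unique_attaching_edge:
  assumes acyc: "\<nexists>c. is_cycle E c" and con: "(adj {e \<in> E. e \<subseteq> S})\<^sup>*\<^sup>* u u'"
    and "u' \<in> S" "v \<notin> S" "adj E u v" "adj E u' v"
  shows "u' = u"
proof (rule ccontr)
  assume ne: "u' \<noteq> u"
  let ?r = "adj {e \<in> E. e \<subseteq> S}"
  obtain p where p: "p \<noteq> []" "distinct p" "hd p = u" "last p = u'" "successively ?r p"
    "set p \<subseteq> insert u' {a. \<exists>b. ?r a b}"
    using rtranclp_imp_distinct_path[OF con] by blast
  have "v \<notin> set p" using p(6) assms by (auto simp: adj_def)
  moreover have "successively (adj E) p"
    using p(5) by (rule successively_mono) (auto simp: adj_def)
  moreover have "length p \<ge> 2"
    using p ne by (cases p; cases "tl p") auto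
  ultimately have "is_cycle E (v # p)"
    using p assms adj_commute[of E v] by (auto simp: is_cycle_def successively_Cons)
  with acyc show False by blast
qed

text \<open>
  Attach the vertices one at a time, giving each new edge a tiny weight: the strict inequality
  survives on the old edges, and the new edge satisfies it because its new endpoint is a leaf.
\<close>

lemma tree_strict_weight:
  assumes fin: "finite V" and tree: "is_tree V E"
  shows "\<exists>w. positive_weight E w \<and> (\<forall>e\<in>E. 1 < (\<Sum>x\<in>e. w e / wdeg E w x))"
proof -
  define F where "F S = {e \<in> E. e \<subseteq> S}" for S
  define D where "D S w x = (\<Sum>e\<in>inc_edges (F S) x. w e)" for S x and w :: "'a set \<Rightarrow> real"
  \<comment> \<open>Connectedness of the induced subgraph is carried along so that a new vertex has
    only one edge into \<open>S\<close>. The weight is positive on all of \<open>E\<close>, but the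
    strict inequality concerns only degrees within \<open>S\<close>.\<close>
  define P where "P S \<longleftrightarrow> (\<forall>a\<in>S. \<forall>b\<in>S. (adj (F S))\<^sup>*\<^sup>* a b) \<and>
    (\<exists>w. positive_weight E w \<and> (\<forall>e\<in>F S. 1 < (\<Sum>x\<in>e. w e / D S w x)))" for S
  have con: "connected_graph V E" and acyc: "\<nexists>c. is_cycle E c"
    using tree by (auto simp: is_tree_def)
  obtain r where r: "r \<in> V" using con by (auto simp: connected_graph_def)
  have fE: "finite E" by (rule finite_E[OF fin])
  have fI: "finite (inc_edges (F S) x)" for S x using fE by (simp add: inc_edges_def F_def)
  have finite_edge: "finite e" if "e \<in> E" for e using edge_card[OF that] by (simp add: card_ge_0_finite)
  have "P V"
  proof (rule connected_graph_grow[OF fin con])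
    show "{r} \<subseteq> V" "{r} \<noteq> {}" using r by auto
    have "F {r} = {}" using edge_card by (fastforce simp: F_def subset_singleton_iff)
    then show "P {r}"
      unfolding P_def by (auto simp: positive_weight_def intro!: exI[of _ "\<lambda>_. 1"])
  next
    fix S u v
    assume S: "S \<subseteq> V" "P S" "u \<in> S" "v \<in> V" "v \<notin> S" "adj E u v"
    define f where "f = {u, v}"
    have conS: "(adj (F S))\<^sup>*\<^sup>* a b" if "a \<in> S" "b \<in> S" for a b using S that by (auto simp: P_def)
    have fE': "f \<in> E" and uv: "u \<noteq> v" and fS: "f \<notin> F S"
      using S by (auto simp: f_def adj_def F_def)
    have F': "F (insert v S) = insert f (F S)"
    proof
      show "F (insert v S) \<subseteq> insert f (F S)"
      proof
        fix e assume e: "e \<in> F (insert v S)"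
        show "e \<in> insert f (F S)"
        proof (cases "v \<in> e")
          case True
          then obtain u' where u': "e = {u', v}" "u' \<noteq> v"
            using e edge_card[of e] by (auto simp: F_def card_2_iff)
          with e have "u' \<in> S" "adj E u' v" by (auto simp: F_def adj_def)
          then have "u' = u"
            using unique_attaching_edge[OF acyc] conS S by (metis F_def)
          then show ?thesis using u' by (simp add: f_def)
        qed (use e in \<open>auto simp: F_def\<close>)
      qed
    qed (use S fE' in \<open>auto simp: F_def f_def\<close>)
    let ?r' = "adj (F (insert v S))"
    have mono: "?r'\<^sup>*\<^sup>* a b" if "a \<in> S" "b \<in> S" for a b
      using conS[OF that] by (rule rtranclp_mono[THEN predicate2D, rotated]) (auto simp: F' adj_def)
    have "?r' u v" "?r' v u" by (auto simp: F' adj_def f_def insert_commute)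
    then have tou: "?r'\<^sup>*\<^sup>* a u" and fromu: "?r'\<^sup>*\<^sup>* u a" if "a \<in> insert v S" for a
      using that mono S by auto
    have conS': "?r'\<^sup>*\<^sup>* a b" if "a \<in> insert v S" "b \<in> insert v S" for a b
      using tou[OF that(1)] fromu[OF that(2)] by (rule rtranclp_trans)
    obtain w where w: "positive_weight E w" "\<And>e. e \<in> F S \<Longrightarrow> 1 < (\<Sum>x\<in>e. w e / D S w x)"
      using S by (auto simp: P_def)
    have D': "D (insert v S) (w(f := \<delta>)) x = D S w x + (if x \<in> f then \<delta> else 0)" for \<delta> x
    proof -
      have "inc_edges (F (insert v S)) x = (if x \<in> f then insert f (inc_edges (F S) x) else inc_edges (F S) x)"
        by (auto simp: F' inc_edges_def)
      moreover have nf: "f \<notin> inc_edges (F S) x" using fS by (simp add: inc_edges_def)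
      moreover have "(\<Sum>e\<in>inc_edges (F S) x. (w(f := \<delta>)) e) = D S w x"
        unfolding D_def using nf by (intro sum.cong) auto
      ultimately show ?thesis using fI by (simp add: D_def)
    qed
    have Dpos: "D S w x > 0" if "e \<in> F S" "x \<in> e" for e x
      unfolding D_def using that w(1) fI
      by (intro sum_pos) (auto simp: inc_edges_def F_def positive_weight_def)
    \<comment> \<open>The perturbed sum tends to the old one as \<delta> decreases to 0, since the
      old degrees are positive. Finiteness of \<open>E\<close> then allows one \<delta> for all old
      edges.\<close>
    have "eventually (\<lambda>\<delta>. 1 < (\<Sum>x\<in>e. w e / (D S w x + (if x \<in> f then \<delta> else 0)))) (at_right 0)"
      if e: "e \<in> F S" for e
    proof -
      have "((\<lambda>\<delta>. \<Sum>x\<in>e. w e / (D S w x + (if x \<in> f then \<delta> else 0))) \<longlongrightarrow>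
          (\<Sum>x\<in>e. w e / (D S w x + 0))) (at_right 0)"
      proof (intro tendsto_sum tendsto_divide tendsto_add tendsto_const)
        show "((\<lambda>\<delta>::real. if x \<in> f then \<delta> else 0) \<longlongrightarrow> 0) (at_right 0)" for x
          by (cases "x \<in> f") (auto intro: tendsto_ident_at)
        show "D S w x + 0 \<noteq> 0" if "x \<in> e" for x using Dpos[OF e that] by simp
      qed
      then show ?thesis by (rule order_tendstoD) (use w(2)[OF e] in simp)
    qed
    then have "eventually (\<lambda>\<delta>. \<forall>e\<in>F S. 1 < (\<Sum>x\<in>e. w e / (D S w x + (if x \<in> f then \<delta> else 0)))) (at_right 0)"
      using fE by (intro eventually_ball_finite) (auto simp: F_def)
    then have "eventually (\<lambda>\<delta>. \<delta> > 0 \<and> (\<forall>e\<in>F S. 1 < (\<Sum>x\<in>e. w e / (D S w x + (if x \<in> f then \<delta> else 0))))) (at_right 0)"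
      using eventually_at_right_less[of "0::real"] by eventually_elim simp
    from eventually_happens[OF this] obtain \<delta> where \<delta>: "\<delta> > 0"
      "\<And>e. e \<in> F S \<Longrightarrow> 1 < (\<Sum>x\<in>e. w e / (D S w x + (if x \<in> f then \<delta> else 0)))"
      by auto
    let ?w = "w(f := \<delta>)"
    have "1 < (\<Sum>x\<in>e. ?w e / D (insert v S) ?w x)" if "e \<in> F (insert v S)" for e
    proof (cases "e = f")
      case True
      \<comment> \<open>The new vertex has weighted degree \<delta>, so its ratio is 1, and the
        ratio at \<open>u\<close> adds a positive amount.\<close>
      have "inc_edges (F S) v = {}" using S by (auto simp: inc_edges_def F_def)
      then have "D S w v = 0" by (simp add: D_def)
      moreover have "D S w u \<ge> 0"
        unfolding D_def using w(1)
        by (intro sum_nonneg) (auto simp: inc_edges_def F_def positive_weight_def less_imp_le)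
      then have "\<delta> / (D S w u + \<delta>) > 0" using \<delta>(1) by (intro divide_pos_pos) auto
      ultimately show ?thesis
        using True \<delta>(1) uv unfolding D' by (simp add: f_def)
    next
      case False
      then show ?thesis using that \<delta>(2)[of e] unfolding D' by (simp add: F')
    qed
    moreover have "positive_weight E ?w" using w(1) \<delta>(1) by (simp add: positive_weight_def)
    ultimately show "P (insert v S)" unfolding P_def using conS' by blast
  qed (rule adj_in_V)
  moreover have "F V = E" using edge_subset by (auto simp: F_def)
  ultimately show ?thesis by (auto simp: P_def D_def wdeg_eq_inc)
qed

section \<open>Finiteness of the distortion\<close>

text \<open>On a finite nonempty edge set any positive weight has finite distortion, so only the
  existence of an admissible weight is at stake.\<close>

lemma DN_LLY_finite_iff:
  assumes fin: "finite V" and ne: "E \<noteq> {}"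
  shows "DN_LLY E < \<infinity> \<longleftrightarrow> (\<exists>w. admissible E w)"
proof
  assume "DN_LLY E < \<infinity>"
  then show "\<exists>w. admissible E w"
    using ne by (auto simp: DN_LLY_def INF_less_iff simp del: ereal_infty_less)
next
  assume "\<exists>w. admissible E w"
  then obtain w where w: "admissible E w" ..
  then have pos: "w e > 0" if "e \<in> E" for e
    using that by (auto simp: admissible_def positive_weight_def)
  obtain e where e: "e \<in> E" using ne by auto
  have fE: "finite E" by (rule finite_E[OF fin])
  define S I where "S = (SUP e\<in>E. ereal (w e))" and "I = (INF e\<in>E. ereal (w e))"
  have "S \<le> ereal (Max (w ` E))" unfolding S_def using fE by (intro SUP_least) auto
  moreover have "ereal (w e) \<le> S" unfolding S_def using e by (rule SUP_upper)
  ultimately obtain s where s: "S = ereal s" by (cases S) auto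
  have "ereal (Min (w ` E)) \<le> I" unfolding I_def using fE by (intro INF_greatest) auto
  moreover have "I \<le> ereal (w e)" unfolding I_def using e by (rule INF_lower)
  moreover have "Min (w ` E) > 0" using fE ne pos by simp
  ultimately obtain i where i: "I = ereal i" "i > 0" by (cases I) auto
  have "weight_distortion E w = ereal (s / i)"
    unfolding weight_distortion_def S_def[symmetric] I_def[symmetric] using s i by simp
  moreover have "DN_LLY E \<le> weight_distortion E w"
    unfolding DN_LLY_def using ne w by (auto intro: INF_lower)
  ultimately show "DN_LLY E < \<infinity>" by (auto intro: le_less_trans)
qed

end

theorem corollary6p6:
  fixes V :: "'a set" and E :: "'a set set"
  assumes "simple_graph V E"
    and "finite V"
    and "connected_graph V E"
    and "girth E \<ge> 6"
  shows "(DN_LLY E < \<infinity> \<longleftrightarrow> is_tree V E \<or> (\<exists>n\<ge>6. is_cycle_graph n V E))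
    \<and> (card E > card V \<longrightarrow> DN_LLY E = \<infinity>)
    \<and> (card E = card V \<longrightarrow> (DN_LLY E < \<infinity> \<longleftrightarrow> (\<exists>n\<ge>6. is_cycle_graph n V E)))"
proof -
  interpret simple_graph V E by fact
  note fin = assms(2) and con = assms(3) and g = assms(4)
  have no_edges: "\<not> is_cycle E c" if "E = {}" for c
    using that by (simp add: is_cycle_def adj_def)
  have V: "V \<noteq> {}" using con by (simp add: connected_graph_def)
  have le: "card E \<le> card V" if DN: "DN_LLY E < \<infinity>"
  proof (cases "E = {}")
    case False
    then show ?thesis using DN DN_LLY_finite_iff[OF fin] admissible_card_le[OF fin con _ g] by blast
  qed simp
  have cycle: "\<exists>n\<ge>6. is_cycle_graph n V E"
    if DN: "DN_LLY E < \<infinity>" and eq: "card E = card V" and c: "is_cycle E c" for c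
  proof -
    have ne: "E \<noteq> {}" using no_edges c by blast
    then obtain w where w: "admissible E w" using DN DN_LLY_finite_iff[OF fin] by blast
    have "is_cycle_graph (length c) V E"
      by (rule two_regular_is_cycle_graph[OF con c admissible_imp_two_regular[OF fin con ne g w eq]])
    then show ?thesis using length_ge_girth[OF g c] by blast
  qed
  \<comment> \<open>The edgeless graph is settled by the convention that its value is 1.\<close>
  have tree_or_cycle: "DN_LLY E < \<infinity>" if "is_tree V E \<or> (\<exists>n\<ge>6. is_cycle_graph n V E)"
  proof (cases "E = {}")
    case False
    have "\<exists>w. admissible E w"
      using that
    proof
      assume "is_tree V E"
      from tree_strict_weight[OF fin this] show ?thesis
        unfolding admissible_iff[OF fin g] by (meson less_imp_le)
    next
      assume "\<exists>n\<ge>6. is_cycle_graph n V E"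
      then obtain n where "n \<ge> 6" "is_cycle_graph n V E" by blast
      then show ?thesis using cycle_graph_admissible[OF fin con g, of n] by auto
    qed
    then show ?thesis using DN_LLY_finite_iff[OF fin False] by blast
  qed (simp add: DN_LLY_def)
  have iff: "DN_LLY E < \<infinity> \<longleftrightarrow> is_tree V E \<or> (\<exists>n\<ge>6. is_cycle_graph n V E)"
  proof
    assume DN: "DN_LLY E < \<infinity>"
    show "is_tree V E \<or> (\<exists>n\<ge>6. is_cycle_graph n V E)"
    proof (cases "\<exists>c. is_cycle E c")
      case True
      then obtain c where c: "is_cycle E c" ..
      \<comment> \<open>Finite distortion bounds the number of edges from above, the cycle bounds it
        from below.\<close>
      have "card E = card V" using le[OF DN] card_le_if_cycle[OF fin con c] by simp
      then show ?thesis using cycle[OF DN _ c] by blast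
    qed (use con in \<open>simp add: is_tree_def\<close>)
  qed (rule tree_or_cycle)
  \<comment> \<open>Summing the strict inequalities of the tree weight gives strictly fewer edges
    than vertices; this rules trees out when the two numbers agree.\<close>
  have tree_card: "card E < card V" if tree: "is_tree V E"
  proof (cases "E = {}")
    case True
    then show ?thesis using V fin by (simp add: card_gt_0_iff)
  next
    case False
    obtain w where w: "positive_weight E w" "\<forall>e\<in>E. 1 < (\<Sum>x\<in>e. w e / wdeg E w x)"
      using tree_strict_weight[OF fin tree] by blast
    have "real (card E) = (\<Sum>e\<in>E. 1)" by simp
    also have "\<dots> < (\<Sum>e\<in>E. \<Sum>x\<in>e. w e / wdeg E w x)"
      using w(2) False finite_E[OF fin] by (intro sum_strict_mono) auto
    also have "\<dots> = real (card V)" by (rule sum_edge_ratios[OF fin con False w(1)])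
    finally show ?thesis by simp
  qed
  show ?thesis
    using iff le tree_card by (auto simp: not_less[symmetric] simp del: ereal_infty_less)
qed

end
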